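(* Let $A$ be a finite set of colours, let $H$ be the characteristic series of the set of planted $A$-coloured tall trees, and let $H^*$ be the characteristic series of the set of all $A$-coloured tall trees. With respect to the deconcatenation coproduct $\delta$, the series $H$ is a primitive element of the restricted dual $(\Bbbk T_A,\,.\,,\Delta)^\circ$, $$\delta(H)=\bullet\otimes H+H\otimes\bullet,$$ and the series $H^*$ is group-like, $$\delta(H^* )=H^*\otimes H^* .$$
   Context: $\Bbbk$ is a field of characteristic zero. A rooted ordered coloured (ROC) tree over a finite set $A$ is a finite rooted tree, with the children of every vertex totally ordered, together with a function from its set of edges to $A$. $T_A$ is the set of ROC trees, $\Bbbk T_A$ the $\Bbbk$-vector space with basis $T_A$, and $\bullet$ the trivial tree (root only). Product: $t\,.\,s$ is obtained by identifying the roots of $t$ and $s$, placing the branches of $t$ to the left of those of $s$; the unit is $\bullet$. Pruning coproduct: $\Delta(t)=\sum t_c\otimes t_s$ over all subtrees $t_s$ of $t$ containing the root (including $\bullet$ and $t$), where $t_c$ is the concatenation of the planted branches of $t$ pruned to obtain $t_s$, in the order inherited from $t$ (left-to-right depth-first order). With these operations $\Bbbk T_A$ is a graded connected Hopf algebra. For $a\in A$, $B_a^+(t)$ is obtained by attaching the root of $t$ to a new root by an additional edge coloured $a$. A planted tall tree is a tree $(B_{a_k}^+\circ\dots\circ B_{a_1}^+)(\bullet)$ with $k\ge1$, $a_i\in A$; it corresponds to the non-empty word $a_1\cdots a_k$. A tall tree is a concatenation of finitely many (possibly zero) planted tall trees; tall trees correspond to sentences over $A$ (finite sequences of non-empty words),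 and planted tall trees to single-word sentences. Thus $H=\sum_w(w)$ over non-empty words $w$ and $H^*=\sum_I I$ over all sentences $I$ (including the empty one, i.e. $\bullet$). A formal tree series is a linear functional $G\in(\Bbbk T_A)^*$, written $G=\sum_{t\in T_A}\langle G,t\rangle t$. Its deconcatenation coproduct is $\delta(G)=\sum_{t,s\in T_A}\langle G,t\,.\,s\rangle\,t\otimes s\in(\Bbbk T_A\otimes\Bbbk T_A)^*$, and $(\Bbbk T_A)^*\otimes(\Bbbk T_A)^*$ is regarded as a subspace via $G_1\otimes G_2=\sum_{t,s}\langle G_1,t\rangle\langle G_2,s\rangle\,t\otimes s$. The restricted (Sweedler) dual $(\Bbbk T_A,\,.\,,\Delta)^\circ$ is the set of $G\in(\Bbbk T_A)^*$ with $\delta(G)\in(\Bbbk T_A)^*\otimes(\Bbbk T_A)^*$. *)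

theory Defs
  imports
    Complex_Main
    "HOL-Library.Poly_Mapping"
    "HOL-Library.Function_Algebras"
begin

text \<open>A tree is given by the left-to-right list of the branches at its root; a branch is the colour
  of its lowest edge together with the tree on top of that edge.\<close>

datatype (colours: 'a) roc_tree = Root (branches: "('a \<times> 'a roc_tree) list")

definition roc_trees :: "'a set \<Rightarrow> 'a roc_tree set"
  where "roc_trees A = {t. colours t \<subseteq> A}"

definition bullet :: "'a roc_tree"
  where "bullet = Root []"

definition tree_mult :: "'a roc_tree \<Rightarrow> 'a roc_tree \<Rightarrow> 'a roc_tree"  (infixl "\<odot>" 70)
  where "t \<odot> s = Root (branches t @ branches s)"

definition B_plus :: "'a \<Rightarrow> 'a roc_tree \<Rightarrow> 'a roc_tree"
  where "B_plus a t = Root [(a, t)]"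

text \<open>For \<open>w = [a\<^sub>1, \<dots>, a\<^sub>k]\<close>, \<open>fold B_plus w bullet\<close> is
  \<open>(B_plus a\<^sub>k \<circ> \<dots> \<circ> B_plus a\<^sub>1) bullet\<close>.\<close>

definition planted_tall_trees :: "'a set \<Rightarrow> 'a roc_tree set"
  where "planted_tall_trees A = {fold B_plus w bullet | w. w \<noteq> [] \<and> set w \<subseteq> A}"

definition tall_trees :: "'a set \<Rightarrow> 'a roc_tree set"
  where "tall_trees A = {foldr (\<odot>) ts bullet | ts. set ts \<subseteq> planted_tall_trees A}"

text \<open>The vector space with basis \<open>B\<close> consists of the \<open>p :: 'b \<Rightarrow>\<^sub>0 'k\<close> supported
  in \<open>B\<close>. A linear functional on it is represented by its extension to all of \<open>'b \<Rightarrow>\<^sub>0 'k\<close>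
  that vanishes on the basis vectors outside \<open>B\<close>, so that equality of functionals is equality
  of functions. The space \<open>V \<otimes> V\<close>, for \<open>V\<close> with basis \<open>B\<close>, is taken to be the
  vector space with basis \<open>B \<times> B\<close>.\<close>

type_synonym ('b, 'k) functional = "('b \<Rightarrow>\<^sub>0 'k) \<Rightarrow> 'k"

definition dual :: "'b set \<Rightarrow> ('b, 'k::field) functional set"
  where "dual B = {G. Vector_Spaces.linear (\<lambda>c. Poly_Mapping.map ((*) c)) (*) G \<and>
                      (\<forall>b. b \<notin> B \<longrightarrow> G (Poly_Mapping.single b 1) = 0)}"

definition coefficient :: "('b, 'k::field) functional \<Rightarrow> 'b \<Rightarrow> 'k"
  where "coefficient G b = G (Poly_Mapping.single b 1)"

text \<open>The functional written as the formal sum of the \<open>c b\<close> times \<open>b\<close>.\<close>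

definition formal_series :: "('b \<Rightarrow> 'k::field) \<Rightarrow> ('b, 'k) functional"
  where "formal_series c = (\<lambda>p. \<Sum>b\<in>Poly_Mapping.keys p. Poly_Mapping.lookup p b * c b)"

definition characteristic_series :: "'b set \<Rightarrow> ('b, 'k::field) functional"
  where "characteristic_series S = formal_series (\<lambda>b. of_bool (b \<in> S))"

definition tensor ::
    "('b, 'k::field) functional \<Rightarrow> ('b, 'k) functional \<Rightarrow> ('b \<times> 'b, 'k) functional"
    (infixr "\<otimes>" 75)
  where "F \<otimes> G = formal_series (\<lambda>(t, s). coefficient F t * coefficient G s)"

text \<open>The image of \<open>dual B \<otimes> dual B\<close> in \<open>dual (B \<times> B)\<close>; sums of functionals are pointwise.\<close>

definition dual_tensor_dual :: "'b set \<Rightarrow> ('b \<times> 'b, 'k::field) functional set"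
  where "dual_tensor_dual B =
    {\<Sum>i<n. F i \<otimes> G i | (n::nat) F G. \<forall>i<n. F i \<in> dual B \<and> G i \<in> dual B}"

definition deconcatenation ::
    "('a roc_tree, 'k::field) functional \<Rightarrow> ('a roc_tree \<times> 'a roc_tree, 'k) functional"  ("\<delta>")
  where "\<delta> G = formal_series (\<lambda>(t, s). coefficient G (t \<odot> s))"

text \<open>The underlying set of the restricted dual of the Hopf algebra of trees depends only on the
  product, through \<open>\<delta>\<close>; the pruning coproduct does not enter its definition.\<close>

definition restricted_dual :: "'a set \<Rightarrow> ('a roc_tree, 'k::field) functional set"
  where "restricted_dual A = {G \<in> dual (roc_trees A). \<delta> G \<in> dual_tensor_dual (roc_trees A)}"

text \<open>The trivial tree regarded as a series. It is the unit of the restricted dual.\<close>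

definition bullet_series :: "('a roc_tree, 'k::field) functional"
  where "bullet_series = characteristic_series {bullet}"

text \<open>The counit of the restricted dual evaluates a series at the unit \<open>bullet\<close> of the
  algebra of trees.\<close>

definition primitive :: "'a set \<Rightarrow> ('a roc_tree, 'k::field) functional \<Rightarrow> bool"
  where "primitive A G \<longleftrightarrow>
    G \<in> restricted_dual A \<and> \<delta> G = bullet_series \<otimes> G + G \<otimes> bullet_series"

definition group_like :: "'a set \<Rightarrow> ('a roc_tree, 'k::field) functional \<Rightarrow> bool"
  where "group_like A G \<longleftrightarrow>
    G \<in> restricted_dual A \<and> coefficient G bullet = 1 \<and> \<delta> G = G \<otimes> G"

definition H_series :: "'a set \<Rightarrow> ('a roc_tree, 'k::field) functional"
  where "H_series A = characteristic_series (planted_tall_trees A)"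

definition H_star_series :: "'a set \<Rightarrow> ('a roc_tree, 'k::field) functional"
  where "H_star_series A = characteristic_series (tall_trees A)"

end

theory Submission
  imports Defs
begin

text \<open>A planted tall tree has exactly one branch at its root, so it can be split as \<open>t \<odot> s\<close> only
  with \<open>t\<close> or \<open>s\<close> trivial. A tree is tall iff each of its branches at the root is planted tall, so
  \<open>t \<odot> s\<close> is tall iff both factors are. All series involved have coefficients 0 and 1, and
  both identities are read off from these equivalences.\<close>

section \<open>Formal series\<close>

lemma lookup_map_mult:
  "Poly_Mapping.lookup (Poly_Mapping.map ((*) c) p) b = (c::'k::field) * Poly_Mapping.lookup p b"
  by (simp add: Poly_Mapping.map.rep_eq when_def)

text \<open>\<open>Vector_Spaces.linear\<close> includes the vector space axioms for source and
  target; this supplies them for the source.\<close>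

lemma vector_space_poly_mapping:
  "vector_space (\<lambda>c::'k::field. Poly_Mapping.map ((*) c) :: ('b \<Rightarrow>\<^sub>0 'k) \<Rightarrow> _)"
  by unfold_locales
    (auto intro!: poly_mapping_eqI simp: lookup_map_mult lookup_add algebra_simps)

text \<open>Terms outside the support vanish, so values of a series at several vectors can be
  compared over one common finite index set.\<close>

lemma formal_series_superset:
  assumes "finite S" "Poly_Mapping.keys p \<subseteq> S"
  shows "formal_series c p = (\<Sum>b\<in>S. Poly_Mapping.lookup p b * c b)"
  unfolding formal_series_def
  by (rule sum.mono_neutral_left) (use assms in \<open>auto simp: in_keys_iff\<close>)

lemma linear_formal_series:
  fixes c :: "'b \<Rightarrow> 'k::field"
  shows "Vector_Spaces.linear (\<lambda>c. Poly_Mapping.map ((*) c)) (*) (formal_series c)"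
proof -
  have add: "formal_series c (p + q) = formal_series c p + formal_series c q" for p q
  proof -
    let ?S = "Poly_Mapping.keys p \<union> Poly_Mapping.keys q"
    have "Poly_Mapping.keys (p + q) \<subseteq> ?S"
      by (rule Poly_Mapping.keys_add)
    then show ?thesis
      by (simp add: formal_series_superset[of ?S] lookup_add distrib_right sum.distrib)
  qed
  have scale: "formal_series c (Poly_Mapping.map ((*) r) p) = r * formal_series c p" for r p
  proof -
    \<comment> \<open>Only an inclusion, since scaling by 0 empties the support.\<close>
    have "Poly_Mapping.keys (Poly_Mapping.map ((*) r) p) \<subseteq> Poly_Mapping.keys p"
      by (auto simp: in_keys_iff lookup_map_mult)
    then show ?thesis
      by (simp add: formal_series_superset[of "Poly_Mapping.keys p"] lookup_map_mult
          sum_distrib_left mult.assoc)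
  qed
  have "vector_space ((*) :: 'k \<Rightarrow> 'k \<Rightarrow> 'k)"
    by unfold_locales (simp_all add: algebra_simps)
  with vector_space_poly_mapping show ?thesis
    by (simp add: Vector_Spaces.linear_iff add scale)
qed

lemma coefficient_formal_series [simp]: "coefficient (formal_series c) b = c b"
  by (simp add: coefficient_def formal_series_def)

lemma formal_series_add:
  "formal_series c + formal_series d = formal_series (\<lambda>b. c b + d b)"
  by (auto simp: formal_series_def plus_fun_def distrib_left sum.distrib)

lemma coefficient_characteristic_series [simp]:
  "coefficient (characteristic_series S) b = of_bool (b \<in> S)"
  by (simp add: characteristic_series_def)

lemma characteristic_series_in_dual:
  assumes "S \<subseteq> B"
  shows "(characteristic_series S :: ('b, 'k::field) functional) \<in> dual B"
proof -
  have "(characteristic_series S :: ('b, 'k) functional) (Poly_Mapping.single b 1) = 0" if "b \<notin> B" for b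
    using assms that coefficient_characteristic_series[of S b, where ?'a = 'k]
    by (auto simp: coefficient_def)
  then show ?thesis
    by (simp add: dual_def characteristic_series_def linear_formal_series)
qed

text \<open>At a common point the sum would have coefficient \<open>1 + 1\<close> instead of 1,
  hence the disjointness.\<close>

lemma characteristic_series_Un:
  assumes "S \<inter> T = {}"
  shows "characteristic_series (S \<union> T) = characteristic_series S + characteristic_series T"
  using assms unfolding characteristic_series_def formal_series_add
  by (intro arg_cong[of _ _ formal_series]) (auto simp: fun_eq_iff)

text \<open>A product of indicators is the indicator of the product set. Together with the analogous
  description of \<open>\<delta>\<close>, this turns identities of series into identities of sets of
  pairs.\<close>

lemma tensor_characteristic_series:
  "characteristic_series S \<otimes> characteristic_series T = characteristic_series (S \<times> T)"
  \<comment> \<open>Only the right-hand series is unfolded; the factors stay folded so that the simp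
    rule for their coefficients applies.\<close>
  unfolding tensor_def characteristic_series_def[of "S \<times> T"]
  by (intro arg_cong[of _ _ formal_series]) (auto simp: fun_eq_iff)

lemma deconcatenation_characteristic_series:
  "\<delta> (characteristic_series S) = characteristic_series {(t, s). t \<odot> s \<in> S}"
  unfolding deconcatenation_def characteristic_series_def[of "{(t, s). t \<odot> s \<in> S}"]
  by (intro arg_cong[of _ _ formal_series]) (auto simp: fun_eq_iff)

lemma tensor_in_dual_tensor_dual:
  assumes "F \<in> dual B" "G \<in> dual B"
  shows "F \<otimes> G \<in> dual_tensor_dual B"
  unfolding dual_tensor_dual_def using assms
  by (intro CollectI exI[of _ "1::nat"] exI[of _ "\<lambda>_. F"] exI[of _ "\<lambda>_. G"]) simp

text \<open>Covers the two-term coproduct of a primitive element.\<close>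

lemma add_tensor_in_dual_tensor_dual:
  assumes "F \<in> dual B" "G \<in> dual B" "F' \<in> dual B" "G' \<in> dual B"
  shows "F \<otimes> G + F' \<otimes> G' \<in> dual_tensor_dual B"
  unfolding dual_tensor_dual_def using assms
  by (intro CollectI exI[of _ "2::nat"] exI[of _ "\<lambda>i. if i = 0 then F else F'"]
      exI[of _ "\<lambda>i. if i = 0 then G else G'"]) (simp add: numeral_2_eq_2)

section \<open>Tall trees\<close>

lemma branches_bullet [simp]: "branches bullet = []"
  by (simp add: bullet_def)

lemma branches_tree_mult [simp]: "branches (t \<odot> s) = branches t @ branches s"
  by (simp add: tree_mult_def)

lemma branches_eq_Nil_iff [simp]: "branches t = [] \<longleftrightarrow> t = bullet"
  by (cases t) (simp add: bullet_def)

lemma bullet_mult [simp]: "bullet \<odot> t = t" "t \<odot> bullet = t"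
  by (simp_all add: tree_mult_def)

lemma planted_tall_tree_branches:
  assumes "t \<in> planted_tall_trees A"
  obtains b where "branches t = [b]"
proof -
  obtain w where "w \<noteq> []" "t = fold B_plus w bullet"
    using assms by (auto simp: planted_tall_trees_def)
  then show thesis
    \<comment> \<open>\<open>fold\<close> applies the last letter of \<open>w\<close> last, so that
      letter colours the edge at the root; hence the split at the end of the word.\<close>
    using that by (cases w rule: rev_cases) (auto simp: B_plus_def)
qed

lemma bullet_not_planted_tall: "bullet \<notin> planted_tall_trees A"
  by (auto elim: planted_tall_tree_branches)

lemma mult_in_planted_tall_trees_iff:
  "t \<odot> s \<in> planted_tall_trees A \<longleftrightarrow>
    t = bullet \<and> s \<in> planted_tall_trees A \<or> t \<in> planted_tall_trees A \<and> s = bullet"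
proof
  assume planted: "t \<odot> s \<in> planted_tall_trees A"
  then obtain b where "branches (t \<odot> s) = [b]"
    by (rule planted_tall_tree_branches)
  then have "t = bullet \<or> s = bullet"
    by (auto simp: append_eq_Cons_conv)
  with planted show
    "t = bullet \<and> s \<in> planted_tall_trees A \<or> t \<in> planted_tall_trees A \<and> s = bullet"
    by auto
qed auto

text \<open>Each planted factor contributes exactly one branch, and conversely every tree is the
  product of its one-branch trees. A condition on single branches is compatible with
  \<open>\<odot>\<close>, which appends branch lists.\<close>

lemma tall_trees_iff:
  "t \<in> tall_trees A \<longleftrightarrow> (\<forall>b\<in>set (branches t). Root [b] \<in> planted_tall_trees A)"
proof
  assume "t \<in> tall_trees A"
  then obtain ts where "set ts \<subseteq> planted_tall_trees A" "t = foldr (\<odot>) ts bullet"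
    by (auto simp: tall_trees_def)
  then show "\<forall>b\<in>set (branches t). Root [b] \<in> planted_tall_trees A"
  proof (induction ts arbitrary: t)
    case (Cons u ts)
    from Cons.prems obtain b where "branches u = [b]"
      by (auto elim: planted_tall_tree_branches)
    moreover from this have "u = Root [b]"
      by (cases u) simp
    ultimately show ?case
      using Cons by auto
  qed simp
next
  have "foldr (\<odot>) (map (\<lambda>b. Root [b]) bs) bullet = Root bs" for bs :: "('a \<times> 'a roc_tree) list"
    by (induction bs) (simp_all add: bullet_def tree_mult_def)
  from this[of "branches t"] have "foldr (\<odot>) (map (\<lambda>b. Root [b]) (branches t)) bullet = t"
    by simp
  moreover assume "\<forall>b\<in>set (branches t). Root [b] \<in> planted_tall_trees A"
  ultimately show "t \<in> tall_trees A"
    unfolding tall_trees_def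
    by (intro CollectI exI[of _ "map (\<lambda>b. Root [b]) (branches t)"]) auto
qed

lemma bullet_in_tall_trees: "bullet \<in> tall_trees A"
  by (simp add: tall_trees_iff)

lemma mult_in_tall_trees_iff:
  "t \<odot> s \<in> tall_trees A \<longleftrightarrow> t \<in> tall_trees A \<and> s \<in> tall_trees A"
  by (auto simp: tall_trees_iff)

lemma bullet_in_roc_trees: "bullet \<in> roc_trees A"
  by (simp add: roc_trees_def bullet_def)

lemma B_plus_in_roc_trees_iff: "B_plus a t \<in> roc_trees A \<longleftrightarrow> a \<in> A \<and> t \<in> roc_trees A"
  by (simp add: roc_trees_def B_plus_def)

lemma mult_in_roc_trees_iff: "t \<odot> s \<in> roc_trees A \<longleftrightarrow> t \<in> roc_trees A \<and> s \<in> roc_trees A"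
  by (cases t; cases s) (auto simp: roc_trees_def tree_mult_def)

text \<open>Needed for membership of the series in \<open>dual (roc_trees A)\<close>, where
  coefficients outside \<open>roc_trees A\<close> must vanish.\<close>

lemma planted_tall_trees_subset: "planted_tall_trees A \<subseteq> roc_trees A"
proof -
  have "set w \<subseteq> A \<Longrightarrow> fold B_plus w bullet \<in> roc_trees A" for w
    by (induction w rule: rev_induct) (simp_all add: bullet_in_roc_trees B_plus_in_roc_trees_iff)
  then show ?thesis
    by (auto simp: planted_tall_trees_def)
qed

lemma tall_trees_subset: "tall_trees A \<subseteq> roc_trees A"
proof -
  have "set ts \<subseteq> planted_tall_trees A \<Longrightarrow> foldr (\<odot>) ts bullet \<in> roc_trees A" for ts
    using planted_tall_trees_subset[of A]
    by (induction ts) (auto simp: bullet_in_roc_trees mult_in_roc_trees_iff)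
  then show ?thesis
    by (auto simp: tall_trees_def)
qed

section \<open>The series of planted tall trees and of tall trees\<close>

lemma primitive_H_series: "primitive A (H_series A :: ('a roc_tree, 'k::field) functional)"
proof -
  let ?H = "H_series A :: ('a roc_tree, 'k) functional"
  let ?P = "planted_tall_trees A"
  have "{(t, s). t \<odot> s \<in> ?P} = {bullet} \<times> ?P \<union> ?P \<times> {bullet}"
    by (auto simp: mult_in_planted_tall_trees_iff)
  \<comment> \<open>A common pair could only be \<open>(bullet, bullet)\<close>, but
    \<open>bullet\<close> is not planted tall because words are non-empty.\<close>
  moreover have "({bullet} \<times> ?P) \<inter> (?P \<times> {bullet}) = {}"
    using bullet_not_planted_tall by auto
  ultimately have delta: "\<delta> ?H = bullet_series \<otimes> ?H + ?H \<otimes> bullet_series"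
    by (simp add: H_series_def bullet_series_def deconcatenation_characteristic_series
        tensor_characteristic_series characteristic_series_Un)
  have "?H \<in> dual (roc_trees A)" "(bullet_series :: ('a roc_tree, 'k) functional) \<in> dual (roc_trees A)"
    by (simp_all add: H_series_def bullet_series_def characteristic_series_in_dual
        planted_tall_trees_subset bullet_in_roc_trees)
  with delta show ?thesis
    by (simp add: primitive_def restricted_dual_def add_tensor_in_dual_tensor_dual)
qed

lemma group_like_H_star_series:
  "group_like A (H_star_series A :: ('a roc_tree, 'k::field) functional)"
proof -
  let ?H = "H_star_series A :: ('a roc_tree, 'k) functional"
  have "{(t, s). t \<odot> s \<in> tall_trees A} = tall_trees A \<times> tall_trees A"
    by (auto simp: mult_in_tall_trees_iff)
  then have delta: "\<delta> ?H = ?H \<otimes> ?H"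
    by (simp add: H_star_series_def deconcatenation_characteristic_series
        tensor_characteristic_series)
  have "?H \<in> dual (roc_trees A)"
    by (simp add: H_star_series_def characteristic_series_in_dual tall_trees_subset)
  \<comment> \<open>The counit condition: the empty sentence counts as a tall tree.\<close>
  moreover have "coefficient ?H bullet = 1"
    by (simp add: H_star_series_def bullet_in_tall_trees)
  ultimately show ?thesis
    using delta by (simp add: group_like_def restricted_dual_def tensor_in_dual_tensor_dual)
qed

theorem proposition6p3:
  fixes A :: "'a set"
  assumes "finite A"
  shows "primitive A (H_series A :: ('a roc_tree, 'k::field_char_0) functional) \<and>
         group_like A (H_star_series A :: ('a roc_tree, 'k) functional)"
  by (simp add: primitive_H_series group_like_H_star_series)

end
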